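(* Let $A$ be a perm subalgebra of a perm algebra $E$, $V$ an $A$-complement of $E$ and $(A,V,\blacktriangleright,\blacktriangleleft,\triangleright,\triangleleft)$ the associated matched pair. Then $\sim$ is an equivalence relation on the set $\mathbf{DM}_{\blacktriangleright,\blacktriangleleft,\triangleright,\triangleleft}(A,V)$ of deformation maps. Denote $\mathcal{H}^{2}_{\blacktriangleright,\blacktriangleleft,\triangleright,\triangleleft}(A,V)=\mathbf{DM}_{\blacktriangleright,\blacktriangleleft,\triangleright,\triangleleft}(A,V)/\sim$. The map $$\mathcal{H}^{2}_{\blacktriangleright,\blacktriangleleft,\triangleright,\triangleleft}(A,V)\to\mathcal{F}(A,E),\qquad[\psi]\mapsto\bar V_\psi,$$ is a bijection, where $[\psi]$ is the equivalence class of $\psi$ and $\bar V_\psi$ is the isomorphism class of $V_\psi$. In particular, $[E:A]=|\mathcal{H}^{2}_{\blacktriangleright,\blacktriangleleft,\triangleright,\triangleleft}(A,V)|$.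
   Context: All vector spaces are over a field $\mathbb{K}$ of characteristic zero. A perm algebra is a vector space $A$ with a bilinear product satisfying $(a_1a_2)a_3=a_1(a_2a_3)=a_1(a_3a_2)$ for all $a_1,a_2,a_3\in A$ (no unit is required). For a perm subalgebra $A$ of $E$, an $A$-complement of $E$ is a perm subalgebra $V$ of $E$ with $E=A+V$ and $A\cap V=\{0\}$. $\mathcal{F}(A,E)$ is the set of isomorphism classes (as perm algebras) of all $A$-complements in $E$, and the factorization index is $[E:A]=|\mathcal{F}(A,E)|$. The associated matched pair of an $A$-complement $V$ consists of the bilinear maps $\blacktriangleright:A\times V\to V$, $\blacktriangleleft:V\times A\to V$, $\triangleright:V\times A\to A$, $\triangleleft:A\times V\to A$ determined by $av=a\triangleleft v+a\blacktriangleright v$ and $va=v\triangleright a+v\blacktriangleleft a$ in $E=A\oplus V$, for $a\in A$, $v\in V$. A linear map $\psi:V\to A$ is a deformation map if for all $v_1,v_2\in V$ $$\psi(v_1v_2)-\psi(v_1)\psi(v_2)=v_1\triangleright\psi(v_2)+\psi(v_1)\triangleleft v_2-\psi(\psi(v_1)\blacktriangleright v_2)-\psi(v_1\blacktriangleleft\psi(v_2)).$$ The set of deformation maps is $\mathbf{DM}_{\blacktriangleright,\blacktriangleleft,\triangleright,\triangleleft}(A,V)$. For a deformation map $\psi$, $V_\psi$ is the perm algebra on the vector space $V$ with product $v_1\cdot_\psi v_2=v_1v_2+\psi(v_1)\blacktriangleright v_2+v_1\blacktriangleleft\psi(v_2)$; it is isomorphic to the $A$-complement $\{\psi(v)+v: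 v\in V\}$ of $E$, so its isomorphism class lies in $\mathcal{F}(A,E)$. Deformation maps $\psi,\phi$ are equivalent, $\psi\sim\phi$, if there is a linear automorphism $\rho:V\to V$ such that for all $v_1,v_2\in V$ $$\rho(v_1v_2)-\rho(v_1)\rho(v_2)=\phi(\rho(v_1))\blacktriangleright\rho(v_2)+\rho(v_1)\blacktriangleleft\phi(\rho(v_2))-\rho(\psi(v_1)\blacktriangleright v_2)-\rho(v_1\blacktriangleleft\psi(v_2)).$$ *)

theory Defs
  imports Complex_Main "HOL-Library.FuncSet"
begin

unbundle cardinal_syntax

text \<open>
  Vector spaces are subspaces of an ambient vector space with scalar multiplication \<open>scale\<close>, on a
  type of class \<open>ab_group_add\<close>; maps between them are constrained on the given subspaces only.
\<close>

definition linear_map_on :: "('k::field \<Rightarrow> 'e::ab_group_add \<Rightarrow> 'e) \<Rightarrow> 'e set \<Rightarrow> 'e set \<Rightarrow> ('e \<Rightarrow> 'e) \<Rightarrow> bool"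
  where "linear_map_on scale U W f \<longleftrightarrow>
    f \<in> U \<rightarrow> W \<and>
    (\<forall>x\<in>U. \<forall>y\<in>U. f (x + y) = f x + f y) \<and>
    (\<forall>c. \<forall>x\<in>U. f (scale c x) = scale c (f x))"

definition bilinear_map_on ::
    "('k::field \<Rightarrow> 'e::ab_group_add \<Rightarrow> 'e) \<Rightarrow> 'e set \<Rightarrow> 'e set \<Rightarrow> 'e set \<Rightarrow> ('e \<Rightarrow> 'e \<Rightarrow> 'e) \<Rightarrow> bool"
  where "bilinear_map_on scale U V W m \<longleftrightarrow>
    (\<forall>u\<in>U. linear_map_on scale V W (\<lambda>v. m u v)) \<and>
    (\<forall>v\<in>V. linear_map_on scale U W (\<lambda>u. m u v))"

definition perm_algebra_on ::
    "('k::field \<Rightarrow> 'e::ab_group_add \<Rightarrow> 'e) \<Rightarrow> 'e set \<Rightarrow> ('e \<Rightarrow> 'e \<Rightarrow> 'e) \<Rightarrow> bool"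
  where "perm_algebra_on scale B m \<longleftrightarrow>
    module.subspace scale B \<and>
    bilinear_map_on scale B B B m \<and>
    (\<forall>x\<in>B. \<forall>y\<in>B. \<forall>z\<in>B. m (m x y) z = m x (m y z) \<and> m x (m y z) = m x (m z y))"

definition perm_subalgebra ::
    "('k::field \<Rightarrow> 'e::ab_group_add \<Rightarrow> 'e) \<Rightarrow> ('e \<Rightarrow> 'e \<Rightarrow> 'e) \<Rightarrow> 'e set \<Rightarrow> 'e set \<Rightarrow> bool"
  where "perm_subalgebra scale m A E \<longleftrightarrow>
    A \<subseteq> E \<and> module.subspace scale A \<and> (\<forall>x\<in>A. \<forall>y\<in>A. m x y \<in> A)"

definition perm_iso_on ::
    "('k::field \<Rightarrow> 'e::ab_group_add \<Rightarrow> 'e) \<Rightarrow>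
      'e set \<Rightarrow> ('e \<Rightarrow> 'e \<Rightarrow> 'e) \<Rightarrow> 'e set \<Rightarrow> ('e \<Rightarrow> 'e \<Rightarrow> 'e) \<Rightarrow> bool"
  where "perm_iso_on scale B m C n \<longleftrightarrow>
    (\<exists>f. linear_map_on scale B C f \<and> bij_betw f B C \<and>
      (\<forall>x\<in>B. \<forall>y\<in>B. f (m x y) = n (f x) (f y)))"

text \<open>
  The isomorphism class of a perm algebra is a proper class. It is represented by the set of all
  perm algebras in it whose underlying vector space is a subspace of the ambient one, with an
  arbitrary product that need not be the product of \<open>E\<close>. Thus the complements of \<open>A\<close> in \<open>E\<close>, with
  the product of \<open>E\<close>, and the algebras \<open>V\<^sub>\<psi>\<close>, with their deformed products on \<open>V\<close>, have
  isomorphism classes in the same sense.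
\<close>

definition perm_iso_class ::
    "('k::field \<Rightarrow> 'e::ab_group_add \<Rightarrow> 'e) \<Rightarrow>
      'e set \<Rightarrow> ('e \<Rightarrow> 'e \<Rightarrow> 'e) \<Rightarrow> ('e set \<times> ('e \<Rightarrow> 'e \<Rightarrow> 'e)) set"
  where "perm_iso_class scale B m =
    {(C, n). perm_algebra_on scale C n \<and> perm_iso_on scale B m C n}"

definition perm_complement ::
    "('k::field \<Rightarrow> 'e::ab_group_add \<Rightarrow> 'e) \<Rightarrow> ('e \<Rightarrow> 'e \<Rightarrow> 'e) \<Rightarrow> 'e set \<Rightarrow> 'e set \<Rightarrow> 'e set \<Rightarrow> bool"
  where "perm_complement scale m A E V \<longleftrightarrow>
    perm_subalgebra scale m V E \<and> E = {a + v |a v. a \<in> A \<and> v \<in> V} \<and> A \<inter> V = {0}"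

definition complement_classes ::
    "('k::field \<Rightarrow> 'e::ab_group_add \<Rightarrow> 'e) \<Rightarrow>
      ('e \<Rightarrow> 'e \<Rightarrow> 'e) \<Rightarrow> 'e set \<Rightarrow> 'e set \<Rightarrow> ('e set \<times> ('e \<Rightarrow> 'e \<Rightarrow> 'e)) set set"
  where "complement_classes scale m A E =
    {perm_iso_class scale W m |W. perm_complement scale m A E W}"

text \<open>
  The index \<open>[E : A]\<close> is a possibly infinite cardinal, to be compared up to \<open>=o\<close>.
\<close>

definition factorization_index ::
    "('k::field \<Rightarrow> 'e::ab_group_add \<Rightarrow> 'e) \<Rightarrow>
      ('e \<Rightarrow> 'e \<Rightarrow> 'e) \<Rightarrow> 'e set \<Rightarrow> 'e set \<Rightarrow> ('e set \<times> ('e \<Rightarrow> 'e \<Rightarrow> 'e)) set rel"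
  where "factorization_index scale m A E = |complement_classes scale m A E|"

text \<open>
  The four maps of a matched pair are named by the colour (\<open>b\<close>lack, \<open>w\<close>hite) and the direction
  (\<open>r\<close>ight, \<open>l\<close>eft) of the triangles denoting them, and take their arguments in the infix order:
  \<open>br : A \<times> V \<rightarrow> V\<close>, \<open>bl : V \<times> A \<rightarrow> V\<close>, \<open>wr : V \<times> A \<rightarrow> A\<close> and \<open>wl : A \<times> V \<rightarrow> A\<close>.
\<close>

definition associated_matched_pair ::
    "('k::field \<Rightarrow> 'e::ab_group_add \<Rightarrow> 'e) \<Rightarrow> ('e \<Rightarrow> 'e \<Rightarrow> 'e) \<Rightarrow> 'e set \<Rightarrow> 'e set \<Rightarrow>
      ('e \<Rightarrow> 'e \<Rightarrow> 'e) \<Rightarrow> ('e \<Rightarrow> 'e \<Rightarrow> 'e) \<Rightarrow> ('e \<Rightarrow> 'e \<Rightarrow> 'e) \<Rightarrow> ('e \<Rightarrow> 'e \<Rightarrow> 'e) \<Rightarrow> bool"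
  where "associated_matched_pair scale m A V br bl wr wl \<longleftrightarrow>
    bilinear_map_on scale A V V br \<and> bilinear_map_on scale V A V bl \<and>
    bilinear_map_on scale V A A wr \<and> bilinear_map_on scale A V A wl \<and>
    (\<forall>a\<in>A. \<forall>v\<in>V. m a v = wl a v + br a v \<and> m v a = wr v a + bl v a)"

text \<open>
  Functions on \<open>V\<close> are represented extensionally, so that distinct elements of this set are distinct
  maps from \<open>V\<close> to \<open>A\<close>.
\<close>

definition deformation_maps ::
    "('k::field \<Rightarrow> 'e::ab_group_add \<Rightarrow> 'e) \<Rightarrow> ('e \<Rightarrow> 'e \<Rightarrow> 'e) \<Rightarrow> 'e set \<Rightarrow> 'e set \<Rightarrow>
      ('e \<Rightarrow> 'e \<Rightarrow> 'e) \<Rightarrow> ('e \<Rightarrow> 'e \<Rightarrow> 'e) \<Rightarrow> ('e \<Rightarrow> 'e \<Rightarrow> 'e) \<Rightarrow> ('e \<Rightarrow> 'e \<Rightarrow> 'e) \<Rightarrow> ('e \<Rightarrow> 'e) set"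
  where "deformation_maps scale m A V br bl wr wl =
    {\<psi> \<in> V \<rightarrow>\<^sub>E A. linear_map_on scale V A \<psi> \<and>
      (\<forall>v1\<in>V. \<forall>v2\<in>V. \<psi> (m v1 v2) - m (\<psi> v1) (\<psi> v2) =
        wr v1 (\<psi> v2) + wl (\<psi> v1) v2 - \<psi> (br (\<psi> v1) v2) - \<psi> (bl v1 (\<psi> v2)))}"

definition deformed_product ::
    "('e::ab_group_add \<Rightarrow> 'e \<Rightarrow> 'e) \<Rightarrow> ('e \<Rightarrow> 'e \<Rightarrow> 'e) \<Rightarrow> ('e \<Rightarrow> 'e \<Rightarrow> 'e) \<Rightarrow> ('e \<Rightarrow> 'e) \<Rightarrow> 'e \<Rightarrow> 'e \<Rightarrow> 'e"
  where "deformed_product m br bl \<psi> v1 v2 = m v1 v2 + br (\<psi> v1) v2 + bl v1 (\<psi> v2)"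

definition deformation_equivalent ::
    "('k::field \<Rightarrow> 'e::ab_group_add \<Rightarrow> 'e) \<Rightarrow> ('e \<Rightarrow> 'e \<Rightarrow> 'e) \<Rightarrow> 'e set \<Rightarrow>
      ('e \<Rightarrow> 'e \<Rightarrow> 'e) \<Rightarrow> ('e \<Rightarrow> 'e \<Rightarrow> 'e) \<Rightarrow> ('e \<Rightarrow> 'e) \<Rightarrow> ('e \<Rightarrow> 'e) \<Rightarrow> bool"
  where "deformation_equivalent scale m V br bl \<psi> \<phi> \<longleftrightarrow>
    (\<exists>\<rho>. linear_map_on scale V V \<rho> \<and> bij_betw \<rho> V V \<and>
      (\<forall>v1\<in>V. \<forall>v2\<in>V. \<rho> (m v1 v2) - m (\<rho> v1) (\<rho> v2) =
        br (\<phi> (\<rho> v1)) (\<rho> v2) + bl (\<rho> v1) (\<phi> (\<rho> v2)) - \<rho> (br (\<psi> v1) v2) - \<rho> (bl v1 (\<psi> v2))))"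

definition deformation_rel ::
    "('k::field \<Rightarrow> 'e::ab_group_add \<Rightarrow> 'e) \<Rightarrow> ('e \<Rightarrow> 'e \<Rightarrow> 'e) \<Rightarrow> 'e set \<Rightarrow> 'e set \<Rightarrow>
      ('e \<Rightarrow> 'e \<Rightarrow> 'e) \<Rightarrow> ('e \<Rightarrow> 'e \<Rightarrow> 'e) \<Rightarrow> ('e \<Rightarrow> 'e \<Rightarrow> 'e) \<Rightarrow> ('e \<Rightarrow> 'e \<Rightarrow> 'e) \<Rightarrow> ('e \<Rightarrow> 'e) rel"
  where "deformation_rel scale m A V br bl wr wl =
    {(\<psi>, \<phi>). \<psi> \<in> deformation_maps scale m A V br bl wr wl \<and>
      \<phi> \<in> deformation_maps scale m A V br bl wr wl \<and>
      deformation_equivalent scale m V br bl \<psi> \<phi>}"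

definition deformation_H2 ::
    "('k::field \<Rightarrow> 'e::ab_group_add \<Rightarrow> 'e) \<Rightarrow> ('e \<Rightarrow> 'e \<Rightarrow> 'e) \<Rightarrow> 'e set \<Rightarrow> 'e set \<Rightarrow>
      ('e \<Rightarrow> 'e \<Rightarrow> 'e) \<Rightarrow> ('e \<Rightarrow> 'e \<Rightarrow> 'e) \<Rightarrow> ('e \<Rightarrow> 'e \<Rightarrow> 'e) \<Rightarrow> ('e \<Rightarrow> 'e \<Rightarrow> 'e) \<Rightarrow> ('e \<Rightarrow> 'e) set set"
  where "deformation_H2 scale m A V br bl wr wl =
    deformation_maps scale m A V br bl wr wl // deformation_rel scale m A V br bl wr wl"

end

theory Submission
  imports Defs
begin

text \<open>
  A linear map \<open>\<psi> : V \<rightarrow> A\<close> is determined by its graph \<open>{\<psi> v + v | v \<in> V}\<close>, and the graphs are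
  exactly the linear complements of \<open>A\<close> in \<open>E\<close>. In \<open>E = A \<oplus> V\<close> the \<open>V\<close>-component of
  \<open>(\<psi> v\<^sub>1 + v\<^sub>1)(\<psi> v\<^sub>2 + v\<^sub>2)\<close> is \<open>v\<^sub>1 \<cdot>\<^sub>\<psi> v\<^sub>2\<close>, so the graph is closed under the product exactly when the
  \<open>A\<close>-component is \<open>\<psi> (v\<^sub>1 \<cdot>\<^sub>\<psi> v\<^sub>2)\<close>, which is the equation of a deformation map
  (\<open>deformation_eq_iff\<close>). Deformation maps therefore correspond to \<open>A\<close>-complements
  (\<open>graph_complement\<close>, \<open>complement_is_graph\<close>), and \<open>v \<mapsto> \<psi> v + v\<close> is an isomorphism from \<open>V\<^sub>\<psi>\<close> to
  the graph of \<open>\<psi>\<close> (\<open>iso_graph\<close>).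

  The equation defining \<open>\<psi> \<sim> \<phi>\<close> says that \<open>\<rho>\<close> is multiplicative from \<open>V\<^sub>\<psi>\<close> to \<open>V\<^sub>\<phi>\<close>
  (\<open>equivalent_iff_iso\<close>). Hence \<open>\<sim>\<close> is the kernel of the map taking \<open>\<psi>\<close> to the isomorphism class
  of \<open>V\<^sub>\<psi>\<close>, whose image is the set of classes of \<open>A\<close>-complements, and the bijection is the one that
  any map induces from the quotient by its kernel onto its image.
\<close>

section \<open>Quotient by the kernel of a map\<close>

lemma equiv_kernel: "equiv D {(x, y). x \<in> D \<and> y \<in> D \<and> f x = f y}"
  by (rule equivI) (auto simp: refl_on_def sym_def trans_def)

lemma bij_betw_quotient_kernel:
  fixes f :: "'a \<Rightarrow> 'b" and D :: "'a set"
  defines "r \<equiv> {(x, y). x \<in> D \<and> y \<in> D \<and> f x = f y}"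
  obtains \<Phi> where "\<And>x. x \<in> D \<Longrightarrow> \<Phi> (r `` {x}) = f x" and "bij_betw \<Phi> (D // r) (f ` D)"
proof
  define \<Phi> where "\<Phi> X = f (SOME x. x \<in> X)" for X
  show on_class: "\<Phi> (r `` {x}) = f x" if "x \<in> D" for x
  proof -
    have "x \<in> r `` {x}"
      using that by (simp add: r_def)
    then have "(SOME y. y \<in> r `` {x}) \<in> r `` {x}"
      by (rule someI)
    then have "f x = f (SOME y. y \<in> r `` {x})"
      unfolding r_def by blast
    then show ?thesis
      by (simp add: \<Phi>_def)
  qed
  have "inj_on \<Phi> (D // r)"
  proof (rule inj_onI)
    fix X Y
    assume "X \<in> D // r" "Y \<in> D // r" and eq: "\<Phi> X = \<Phi> Y"
    then obtain x y where "x \<in> D" "X = r `` {x}" "y \<in> D" "Y = r `` {y}"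
      by (auto elim!: quotientE)
    with eq show "X = Y"
      by (auto simp: on_class) (auto simp: r_def)
  qed
  moreover have "\<Phi> ` (D // r) = f ` D"
    unfolding quotient_def image_UN by (simp add: on_class UNION_singleton_eq_range)
  ultimately show "bij_betw \<Phi> (D // r) (f ` D)"
    by (simp add: bij_betw_def)
qed

section \<open>Linear maps and isomorphisms on subspaces\<close>

lemma linear_map_on_closed: "linear_map_on scale U W f \<Longrightarrow> x \<in> U \<Longrightarrow> f x \<in> W"
  and linear_map_on_add:
    "linear_map_on scale U W f \<Longrightarrow> x \<in> U \<Longrightarrow> y \<in> U \<Longrightarrow> f (x + y) = f x + f y"
  and linear_map_on_scale:
    "linear_map_on scale U W f \<Longrightarrow> x \<in> U \<Longrightarrow> f (scale c x) = scale c (f x)"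
  by (auto simp: linear_map_on_def)

lemma bilinear_map_on_left:
    "bilinear_map_on scale U V W b \<Longrightarrow> v \<in> V \<Longrightarrow> linear_map_on scale U W (\<lambda>u. b u v)"
  and bilinear_map_on_right:
    "bilinear_map_on scale U V W b \<Longrightarrow> u \<in> U \<Longrightarrow> linear_map_on scale V W (\<lambda>v. b u v)"
  by (auto simp: bilinear_map_on_def)

lemma bilinear_map_on_closed:
  "bilinear_map_on scale U V W b \<Longrightarrow> u \<in> U \<Longrightarrow> v \<in> V \<Longrightarrow> b u v \<in> W"
  by (rule linear_map_on_closed[OF bilinear_map_on_right])

lemma linear_map_on_compose:
  "linear_map_on scale U V f \<Longrightarrow> linear_map_on scale V W g \<Longrightarrow> linear_map_on scale U W (\<lambda>x. g (f x))"
  by (auto simp: linear_map_on_def Pi_iff)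

lemma (in vector_space) linear_map_on_sum:
  assumes "subspace W" "linear_map_on scale U W f" "linear_map_on scale U W g"
  shows "linear_map_on scale U W (\<lambda>x. f x + g x)"
  using assms by (auto simp: linear_map_on_def Pi_iff subspace_add scale_right_distrib)

lemma perm_algebra_onD:
  assumes "perm_algebra_on scale B n"
  shows perm_algebra_on_subspace: "module.subspace scale B"
    and perm_algebra_on_bilinear: "bilinear_map_on scale B B B n"
    and perm_algebra_on_closed: "\<And>x y. x \<in> B \<Longrightarrow> y \<in> B \<Longrightarrow> n x y \<in> B"
  using assms bilinear_map_on_closed[of scale B B B n] by (simp_all add: perm_algebra_on_def)

lemma perm_iso_on_refl: "perm_iso_on scale B n B n"
  unfolding perm_iso_on_def
  by (rule exI[of _ "\<lambda>x. x"]) (auto simp: linear_map_on_def bij_betw_def inj_on_def)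

lemma perm_iso_on_trans:
  assumes "perm_iso_on scale B n B' n'" "perm_iso_on scale B' n' B'' n''"
  shows "perm_iso_on scale B n B'' n''"
proof -
  obtain f where f: "linear_map_on scale B B' f" "bij_betw f B B'"
    "\<And>x y. x \<in> B \<Longrightarrow> y \<in> B \<Longrightarrow> f (n x y) = n' (f x) (f y)"
    using assms(1) by (auto simp: perm_iso_on_def)
  obtain g where g: "linear_map_on scale B' B'' g" "bij_betw g B' B''"
    "\<And>x y. x \<in> B' \<Longrightarrow> y \<in> B' \<Longrightarrow> g (n' x y) = n'' (g x) (g y)"
    using assms(2) by (auto simp: perm_iso_on_def)
  have "linear_map_on scale B B'' (g \<circ> f)"
    using linear_map_on_compose[OF f(1) g(1)] by (simp add: comp_def)
  moreover have "bij_betw (g \<circ> f) B B''"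
    using f(2) g(2) by (rule bij_betw_trans)
  ultimately show ?thesis
    unfolding perm_iso_on_def using f(3) g(3) linear_map_on_closed[OF f(1)]
    by (intro exI[of _ "g \<circ> f"]) auto
qed

lemma (in vector_space) perm_iso_on_sym:
  assumes B: "subspace B" and closed: "\<And>x y. x \<in> B \<Longrightarrow> y \<in> B \<Longrightarrow> n x y \<in> B"
    and iso: "perm_iso_on scale B n C n'"
  shows "perm_iso_on scale C n' B n"
proof -
  obtain f where f: "linear_map_on scale B C f" "bij_betw f B C"
    "\<And>x y. x \<in> B \<Longrightarrow> y \<in> B \<Longrightarrow> f (n x y) = n' (f x) (f y)"
    using iso by (auto simp: perm_iso_on_def)
  let ?g = "inv_into B f"
  have g: "?g x \<in> B" "f (?g x) = x" if "x \<in> C" for x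
    using that f(2) by (auto simp: bij_betw_def inv_into_into f_inv_into_f)
  have gf: "?g (f x) = x" if "x \<in> B" for x
    using that f(2) by (simp add: bij_betw_inv_into_left)
  have "?g (x + y) = ?g x + ?g y" if "x \<in> C" "y \<in> C" for x y
    using gf[of "?g x + ?g y"] g[OF that(1)] g[OF that(2)] B
    by (simp add: linear_map_on_add[OF f(1)] subspace_add)
  moreover have "?g (scale c x) = scale c (?g x)" if "x \<in> C" for c x
    using gf[of "scale c (?g x)"] g[OF that] B
    by (simp add: linear_map_on_scale[OF f(1)] subspace_scale)
  moreover have "?g (n' x y) = n (?g x) (?g y)" if "x \<in> C" "y \<in> C" for x y
    using gf[of "n (?g x) (?g y)"] g[OF that(1)] g[OF that(2)] by (simp add: f(3) closed)
  moreover have "bij_betw ?g C B"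
    using f(2) by (rule bij_betw_inv_into)
  ultimately show ?thesis
    unfolding perm_iso_on_def linear_map_on_def using g(1) by (intro exI[of _ ?g]) auto
qed

lemma (in vector_space) perm_iso_class_eq_iff:
  assumes B: "perm_algebra_on scale B n" and C: "perm_algebra_on scale C n'"
  shows "perm_iso_class scale B n = perm_iso_class scale C n' \<longleftrightarrow> perm_iso_on scale B n C n'"
proof
  assume "perm_iso_class scale B n = perm_iso_class scale C n'"
  moreover have "(C, n') \<in> perm_iso_class scale C n'"
    using C perm_iso_on_refl by (auto simp: perm_iso_class_def)
  ultimately show "perm_iso_on scale B n C n'"
    by (auto simp: perm_iso_class_def)
next
  assume iso: "perm_iso_on scale B n C n'"
  then have "perm_iso_on scale C n' B n"
    using perm_iso_on_sym[of B n] perm_algebra_onD[OF B] by blast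
  with iso show "perm_iso_class scale B n = perm_iso_class scale C n'"
    by (auto simp: perm_iso_class_def intro: perm_iso_on_trans)
qed

lemma (in vector_space) perm_algebra_on_subalgebra:
  assumes E: "perm_algebra_on scale E m" and W: "perm_subalgebra scale m W E"
  shows "perm_algebra_on scale W m"
proof -
  have WE: "\<And>x. x \<in> W \<Longrightarrow> x \<in> E" and closed: "\<And>x y. x \<in> W \<Longrightarrow> y \<in> W \<Longrightarrow> m x y \<in> W"
    and "subspace W"
    using W by (auto simp: perm_subalgebra_def)
  moreover have "bilinear_map_on scale W W W m"
    using perm_algebra_on_bilinear[OF E] closed
    by (simp add: bilinear_map_on_def linear_map_on_def Pi_iff WE)
  moreover have "\<forall>x\<in>W. \<forall>y\<in>W. \<forall>z\<in>W. m (m x y) z = m x (m y z) \<and> m x (m y z) = m x (m z y)"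
    using E WE unfolding perm_algebra_on_def by blast
  ultimately show ?thesis
    by (simp add: perm_algebra_on_def)
qed

text \<open>The perm identities are pulled back along an injective multiplicative map.\<close>

lemma perm_algebra_on_pullback:
  assumes B: "module.subspace scale B" "bilinear_map_on scale B B B n"
    and C: "perm_algebra_on scale C n'"
    and f: "f \<in> B \<rightarrow> C" "inj_on f B" "\<And>x y. x \<in> B \<Longrightarrow> y \<in> B \<Longrightarrow> f (n x y) = n' (f x) (f y)"
  shows "perm_algebra_on scale B n"
proof -
  have "n (n x y) z = n x (n y z) \<and> n x (n y z) = n x (n z y)"
    if xyz: "x \<in> B" "y \<in> B" "z \<in> B" for x y z
  proof -
    have closed: "n u v \<in> B" if "u \<in> B" "v \<in> B" for u v
      using bilinear_map_on_closed[OF B(2)] that by blast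
    have "f x \<in> C" "f y \<in> C" "f z \<in> C"
      using f(1) xyz by auto
    then have "f (n (n x y) z) = f (n x (n y z))" "f (n x (n y z)) = f (n x (n z y))"
      using C xyz unfolding perm_algebra_on_def by (simp_all add: f(3) closed)
    then show ?thesis
      using f(2) xyz closed by (simp add: inj_on_eq_iff)
  qed
  with B show ?thesis
    by (simp add: perm_algebra_on_def)
qed

section \<open>Deformation maps and complements\<close>

text \<open>
  A perm algebra \<open>E\<close> that is the direct sum of perm subalgebras \<open>A\<close> and \<open>V\<close>, with the four maps of
  the associated matched pair.
\<close>

locale perm_factorization = vector_space scale
  for scale :: "'k::field \<Rightarrow> 'e::ab_group_add \<Rightarrow> 'e" +
  fixes m :: "'e \<Rightarrow> 'e \<Rightarrow> 'e" and E A V :: "'e set" and br bl wr wl :: "'e \<Rightarrow> 'e \<Rightarrow> 'e"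
  assumes E: "perm_algebra_on scale E m"
    and A: "perm_subalgebra scale m A E"
    and V: "perm_complement scale m A E V"
    and mp: "associated_matched_pair scale m A V br bl wr wl"
begin

abbreviation "DM \<equiv> deformation_maps scale m A V br bl wr wl"
text \<open>The product of \<open>V\<^sub>\<psi>\<close>, which makes sense for every linear map \<open>\<psi> : V \<rightarrow> A\<close>.\<close>

abbreviation "V_prod \<equiv> deformed_product m br bl"

lemma subspace_A: "subspace A" and subspace_V: "subspace V"
  and A_E: "a \<in> A \<Longrightarrow> a \<in> E" and V_E: "v \<in> V \<Longrightarrow> v \<in> E"
  and A_mult: "a \<in> A \<Longrightarrow> a' \<in> A \<Longrightarrow> m a a' \<in> A"
  and E_eq: "E = {a + v |a v. a \<in> A \<and> v \<in> V}" and A_Int_V: "A \<inter> V = {0}"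
  using A V by (auto simp: perm_subalgebra_def perm_complement_def)

lemma subspace_E: "subspace E"
  by (rule perm_algebra_on_subspace[OF E])

lemma perm_algebra_V: "perm_algebra_on scale V m"
  using perm_algebra_on_subalgebra[OF E] V unfolding perm_complement_def by blast

lemma bilinear_V: "bilinear_map_on scale V V V m"
  by (rule perm_algebra_on_bilinear[OF perm_algebra_V])

lemma bilinear_br: "bilinear_map_on scale A V V br"
  and bilinear_bl: "bilinear_map_on scale V A V bl"
  and bilinear_wr: "bilinear_map_on scale V A A wr"
  and bilinear_wl: "bilinear_map_on scale A V A wl"
  and AV_mult: "a \<in> A \<Longrightarrow> v \<in> V \<Longrightarrow> m a v = wl a v + br a v"
  and VA_mult: "a \<in> A \<Longrightarrow> v \<in> V \<Longrightarrow> m v a = wr v a + bl v a"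
  using mp by (auto simp: associated_matched_pair_def)

lemmas maps_closed =
  bilinear_map_on_closed[OF bilinear_V] bilinear_map_on_closed[OF bilinear_br]
  bilinear_map_on_closed[OF bilinear_bl] bilinear_map_on_closed[OF bilinear_wr]
  bilinear_map_on_closed[OF bilinear_wl]

lemma direct_sum_unique:
  assumes "a \<in> A" "v \<in> V" "a' \<in> A" "v' \<in> V" and eq: "a + v = a' + v'"
  shows "a = a'" "v = v'"
proof -
  have "a - a' = v' - v"
    using eq by (simp add: algebra_simps)
  moreover have "a - a' \<in> A" "v' - v \<in> V"
    using assms subspace_A subspace_V by (simp_all add: subspace_diff)
  ultimately have "a - a' \<in> A \<inter> V"
    by simp
  then show "a = a'"
    using A_Int_V by simp
  with eq show "v = v'"
    by simp
qed

lemma mult_components: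
  assumes "a \<in> A" "v \<in> V" "a' \<in> A" "v' \<in> V"
  shows "m (a + v) (a' + v')
    = (m a a' + wr v a' + wl a v') + (m v v' + br a v' + bl v a')"
proof -
  note bil = perm_algebra_on_bilinear[OF E]
  note mem = A_E[OF assms(1)] V_E[OF assms(2)] A_E[OF assms(3)] V_E[OF assms(4)]
  have "m (a + v) (a' + v') = m a (a' + v') + m v (a' + v')"
    using linear_map_on_add[OF bilinear_map_on_left[OF bil]] mem subspace_E
    by (simp add: subspace_add)
  also have "\<dots> = m a a' + m a v' + (m v a' + m v v')"
    using linear_map_on_add[OF bilinear_map_on_right[OF bil]] mem by simp
  finally show ?thesis
    using assms by (simp add: AV_mult VA_mult algebra_simps)
qed

lemma mult_components_closed:
  assumes "a \<in> A" "v \<in> V" "a' \<in> A" "v' \<in> V"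
  shows "m a a' + wr v a' + wl a v' \<in> A" "m v v' + br a v' + bl v a' \<in> V"
  using assms subspace_A subspace_V by (simp_all add: subspace_add maps_closed A_mult)

lemma V_prod_closed:
  assumes "linear_map_on scale V A \<psi>" "v1 \<in> V" "v2 \<in> V"
  shows "V_prod \<psi> v1 v2 \<in> V"
  using assms subspace_V linear_map_on_closed[OF assms(1)]
  by (simp add: deformed_product_def subspace_add maps_closed)

lemma linear_V_prod:
  assumes \<rho>: "linear_map_on scale V W \<rho>" and \<psi>: "linear_map_on scale V A \<psi>"
    and v: "v1 \<in> V" "v2 \<in> V"
  shows "\<rho> (V_prod \<psi> v1 v2) = \<rho> (m v1 v2) + \<rho> (br (\<psi> v1) v2) + \<rho> (bl v1 (\<psi> v2))"
  using v subspace_V linear_map_on_closed[OF \<psi>]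
  by (simp add: deformed_product_def linear_map_on_add[OF \<rho>] subspace_add maps_closed)

text \<open>
  Both equations compare \<open>\<psi> (v\<^sub>1 \<cdot>\<^sub>\<psi> v\<^sub>2)\<close> with the \<open>A\<close>-component of \<open>(\<psi> v\<^sub>1 + v\<^sub>1)(\<psi> v\<^sub>2 + v\<^sub>2)\<close>. The
  second one says that \<open>v \<mapsto> \<psi> v + v\<close> is multiplicative from \<open>V\<^sub>\<psi>\<close> to \<open>E\<close>.
\<close>

lemma deformation_eq_iff:
  assumes \<psi>: "linear_map_on scale V A \<psi>" and v: "v1 \<in> V" "v2 \<in> V"
  shows "\<psi> (m v1 v2) - m (\<psi> v1) (\<psi> v2) =
      wr v1 (\<psi> v2) + wl (\<psi> v1) v2 - \<psi> (br (\<psi> v1) v2) - \<psi> (bl v1 (\<psi> v2)) \<longleftrightarrow>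
    m (\<psi> v1 + v1) (\<psi> v2 + v2) = \<psi> (V_prod \<psi> v1 v2) + V_prod \<psi> v1 v2"
proof -
  have "m (\<psi> v1 + v1) (\<psi> v2 + v2) =
      (m (\<psi> v1) (\<psi> v2) + wr v1 (\<psi> v2) + wl (\<psi> v1) v2) + V_prod \<psi> v1 v2"
    using mult_components[of "\<psi> v1" v1 "\<psi> v2" v2] v linear_map_on_closed[OF \<psi>]
    by (simp add: deformed_product_def)
  then show ?thesis
    by (simp add: linear_V_prod[OF \<psi> \<psi> v]) (auto simp: algebra_simps)
qed

lemma DM_linear: "\<psi> \<in> DM \<Longrightarrow> linear_map_on scale V A \<psi>"
  by (simp add: deformation_maps_def)

lemma DM_mult:
  assumes "\<psi> \<in> DM" "v1 \<in> V" "v2 \<in> V"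
  shows "m (\<psi> v1 + v1) (\<psi> v2 + v2) = \<psi> (V_prod \<psi> v1 v2) + V_prod \<psi> v1 v2"
  using assms deformation_eq_iff[OF DM_linear[OF assms(1)] assms(2,3)]
  by (simp add: deformation_maps_def)

lemma DM_closed: "\<psi> \<in> DM \<Longrightarrow> v \<in> V \<Longrightarrow> \<psi> v \<in> A"
  using DM_linear linear_map_on_closed by blast

lemma graph_subset_E: "\<psi> \<in> DM \<Longrightarrow> v \<in> V \<Longrightarrow> \<psi> v + v \<in> E"
  using DM_closed E_eq by blast

lemma inj_on_graph: "\<psi> \<in> DM \<Longrightarrow> inj_on (\<lambda>v. \<psi> v + v) V"
  by (rule inj_onI) (metis DM_closed direct_sum_unique(2))

lemma bilinear_V_prod:
  assumes \<psi>: "linear_map_on scale V A \<psi>"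
  shows "bilinear_map_on scale V V V (V_prod \<psi>)"
proof -
  note \<psi>_closed = linear_map_on_closed[OF \<psi>]
  have "linear_map_on scale V V (V_prod \<psi> u)" if "u \<in> V" for u
    unfolding deformed_product_def
    using that \<psi>_closed
    by (intro linear_map_on_sum[OF subspace_V] linear_map_on_compose[OF \<psi>]
        bilinear_map_on_right[OF bilinear_V] bilinear_map_on_right[OF bilinear_br]
        bilinear_map_on_right[OF bilinear_bl])
  moreover have "linear_map_on scale V V (\<lambda>u. V_prod \<psi> u v)" if "v \<in> V" for v
    unfolding deformed_product_def
    using that \<psi>_closed
    by (intro linear_map_on_sum[OF subspace_V] bilinear_map_on_left[OF bilinear_V]
        bilinear_map_on_left[OF bilinear_bl]
        linear_map_on_compose[OF \<psi> bilinear_map_on_left[OF bilinear_br]])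
  ultimately show ?thesis
    by (simp add: bilinear_map_on_def)
qed

text \<open>
  The map \<open>v \<mapsto> \<psi> v + v\<close> embeds \<open>V\<^sub>\<psi>\<close> into \<open>E\<close>, so \<open>V\<^sub>\<psi>\<close> inherits the perm identities of \<open>E\<close>.
\<close>

lemma perm_algebra_V_prod: "\<psi> \<in> DM \<Longrightarrow> perm_algebra_on scale V (V_prod \<psi>)"
  using perm_algebra_on_pullback[OF subspace_V bilinear_V_prod E _ inj_on_graph]
  by (simp add: DM_linear DM_mult Pi_iff graph_subset_E)

lemma iso_graph:
  assumes "\<psi> \<in> DM"
  shows "perm_iso_on scale V (V_prod \<psi>) ((\<lambda>v. \<psi> v + v) ` V) m"
  unfolding perm_iso_on_def
proof (intro exI conjI)
  note lin = DM_linear[OF assms]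
  show "linear_map_on scale V ((\<lambda>v. \<psi> v + v) ` V) (\<lambda>v. \<psi> v + v)"
    by (simp add: linear_map_on_def linear_map_on_add[OF lin] linear_map_on_scale[OF lin]
        scale_right_distrib algebra_simps)
  show "bij_betw (\<lambda>v. \<psi> v + v) V ((\<lambda>v. \<psi> v + v) ` V)"
    using inj_on_graph[OF assms] by (simp add: bij_betw_def)
qed (simp add: DM_mult[OF assms])

lemma graph_complement:
  assumes "\<psi> \<in> DM"
  shows "perm_complement scale m A E ((\<lambda>v. \<psi> v + v) ` V)" (is "perm_complement _ _ _ _ ?W")
proof -
  note lin = DM_linear[OF assms] and closed = DM_closed[OF assms]
  have zero: "\<psi> 0 = 0"
    using linear_map_on_scale[OF lin, of 0 0] subspace_0[OF subspace_V] by simp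
  have "subspace ?W"
  proof (rule subspaceI)
    show "0 \<in> ?W"
      using zero subspace_0[OF subspace_V] by (auto intro!: image_eqI[of _ _ 0])
    fix x y assume "x \<in> ?W" "y \<in> ?W"
    then obtain u v where uv: "u \<in> V" "v \<in> V" "x = \<psi> u + u" "y = \<psi> v + v"
      by blast
    then have "x + y = \<psi> (u + v) + (u + v)"
      by (simp add: linear_map_on_add[OF lin] algebra_simps)
    then show "x + y \<in> ?W"
      using uv subspace_add[OF subspace_V] by blast
  next
    fix c x assume "x \<in> ?W"
    then obtain u where u: "u \<in> V" "x = \<psi> u + u"
      by blast
    then have "scale c x = \<psi> (scale c u) + scale c u"
      by (simp add: linear_map_on_scale[OF lin] scale_right_distrib)
    then show "scale c x \<in> ?W"
      using u subspace_scale[OF subspace_V] by blast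
  qed
  moreover have "?W \<subseteq> E"
    using graph_subset_E[OF assms] by blast
  moreover have "m x y \<in> ?W" if "x \<in> ?W" "y \<in> ?W" for x y
    using that DM_mult[OF assms] V_prod_closed[OF lin] by blast
  ultimately have "perm_subalgebra scale m ?W E"
    by (simp add: perm_subalgebra_def)
  moreover have "E = {a + w |a w. a \<in> A \<and> w \<in> ?W}"
  proof (intro subset_antisym subsetI)
    fix x assume "x \<in> E"
    then obtain a v where av: "a \<in> A" "v \<in> V" "x = a + v"
      using E_eq by auto
    then have "x = (a - \<psi> v) + (\<psi> v + v)" "a - \<psi> v \<in> A"
      using subspace_diff[OF subspace_A] closed by auto
    with av(2) show "x \<in> {a + w |a w. a \<in> A \<and> w \<in> ?W}"
      by blast
  next
    fix x assume "x \<in> {a + w |a w. a \<in> A \<and> w \<in> ?W}"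
    then show "x \<in> E"
      using \<open>?W \<subseteq> E\<close> A_E subspace_add[OF subspace_E] by auto
  qed
  moreover have "A \<inter> ?W = {0}"
  proof -
    have "x = 0" if x: "x \<in> A" "x \<in> ?W" for x
    proof -
      obtain v where v: "v \<in> V" "x = \<psi> v + v"
        using x(2) by blast
      have "x + 0 = \<psi> v + v"
        using v by simp
      then have "v = 0"
        using direct_sum_unique(2)[of x 0 "\<psi> v" v] x(1) v(1) closed subspace_0[OF subspace_V]
        by simp
      with v(2) zero show ?thesis
        by simp
    qed
    then show ?thesis
      using subspace_0[OF subspace_A] subspace_0[OF \<open>subspace ?W\<close>] by auto
  qed
  ultimately show ?thesis
    by (simp add: perm_complement_def)
qed

text \<open>
  If \<open>E = A \<oplus> W\<close>, then for each \<open>v\<close> in \<open>V\<close> there is exactly one \<open>a\<close> in \<open>A\<close> with \<open>a + v\<close> in \<open>W\<close>.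
  This \<open>a\<close> is the value at \<open>v\<close> of the linear map with graph \<open>W\<close>, and the deformation equation holds
  because \<open>W\<close> is closed under the product.
\<close>

lemma complement_is_graph:
  assumes "perm_complement scale m A E W"
  obtains \<psi> where "\<psi> \<in> DM" "W = (\<lambda>v. \<psi> v + v) ` V"
proof -
  have subspace_W: "subspace W" and WE: "W \<subseteq> E"
    and W_mult: "\<And>x y. x \<in> W \<Longrightarrow> y \<in> W \<Longrightarrow> m x y \<in> W"
    and E_W: "E = {a + w |a w. a \<in> A \<and> w \<in> W}" and A_W: "A \<inter> W = {0}"
    using assms by (auto simp: perm_complement_def perm_subalgebra_def)
  have ex: "\<exists>a. a \<in> A \<and> a + v \<in> W" if v: "v \<in> V" for v
  proof -
    obtain a w where aw: "a \<in> A" "w \<in> W" "v = a + w"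
      using V_E[OF v] E_W by auto
    then have "- a + v = w"
      by simp
    with aw show ?thesis
      using subspace_neg[OF subspace_A] by metis
  qed
  have unique: "a = a'" if "a \<in> A" "a + v \<in> W" "a' \<in> A" "a' + v \<in> W" for a a' v
  proof -
    have "(a + v) - (a' + v) \<in> W" "a - a' \<in> A"
      using that subspace_diff[OF subspace_W] subspace_diff[OF subspace_A] by blast+
    then have "a - a' \<in> A \<inter> W"
      by simp
    then show ?thesis
      using A_W by simp
  qed
  define \<psi> where "\<psi> = (\<lambda>v\<in>V. SOME a. a \<in> A \<and> a + v \<in> W)"
  have \<psi>: "\<psi> v \<in> A" "\<psi> v + v \<in> W" if "v \<in> V" for v
    using someI_ex[OF ex[OF that]] that by (simp_all add: \<psi>_def)
  have \<psi>_eq: "\<psi> v = a" if "v \<in> V" "a \<in> A" "a + v \<in> W" for v a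
    using unique \<psi> that by blast
  have lin: "linear_map_on scale V A \<psi>"
  proof -
    have "\<psi> (u + v) = \<psi> u + \<psi> v" if "u \<in> V" "v \<in> V" for u v
    proof (rule \<psi>_eq)
      show "\<psi> u + \<psi> v + (u + v) \<in> W"
        using subspace_add[OF subspace_W \<psi>(2)[OF that(1)] \<psi>(2)[OF that(2)]]
        by (simp add: algebra_simps)
    qed (use that \<psi> subspace_add subspace_A subspace_V in auto)
    moreover have "\<psi> (scale c v) = scale c (\<psi> v)" if "v \<in> V" for c v
    proof (rule \<psi>_eq)
      show "scale c (\<psi> v) + scale c v \<in> W"
        using subspace_scale[OF subspace_W \<psi>(2)[OF that], of c]
        by (simp add: scale_right_distrib)
    qed (use that \<psi> subspace_scale subspace_A subspace_V in auto)
    ultimately show ?thesis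
      using \<psi>(1) by (simp add: linear_map_on_def)
  qed
  have "m (\<psi> v1 + v1) (\<psi> v2 + v2) = \<psi> (V_prod \<psi> v1 v2) + V_prod \<psi> v1 v2"
    if v: "v1 \<in> V" "v2 \<in> V" for v1 v2
  proof -
    let ?a = "m (\<psi> v1) (\<psi> v2) + wr v1 (\<psi> v2) + wl (\<psi> v1) v2"
    have eq: "m (\<psi> v1 + v1) (\<psi> v2 + v2) = ?a + V_prod \<psi> v1 v2"
      using mult_components[of "\<psi> v1" v1 "\<psi> v2" v2] v \<psi>(1) by (simp add: deformed_product_def)
    moreover have "?a \<in> A"
      using mult_components_closed(1) v \<psi>(1) by blast
    moreover have "m (\<psi> v1 + v1) (\<psi> v2 + v2) \<in> W"
      using W_mult \<psi>(2) v by blast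
    ultimately have "\<psi> (V_prod \<psi> v1 v2) = ?a"
      using \<psi>_eq V_prod_closed[OF lin v] by simp
    with eq show ?thesis
      by simp
  qed
  then have "\<psi> \<in> DM"
    using lin \<psi>(1) unfolding deformation_maps_def
    by (auto simp: deformation_eq_iff[OF lin] PiE_iff) (simp_all add: \<psi>_def)
  moreover have "W = (\<lambda>v. \<psi> v + v) ` V"
  proof (intro subset_antisym subsetI)
    fix w assume w: "w \<in> W"
    then obtain a v where "a \<in> A" "v \<in> V" "w = a + v"
      using WE E_eq by blast
    with w \<psi>_eq show "w \<in> (\<lambda>v. \<psi> v + v) ` V"
      by blast
  qed (use \<psi>(2) in auto)
  ultimately show thesis
    by (rule that)
qed

section \<open>Equivalence and isomorphism classes\<close>

text \<open>
  The same \<open>\<rho>\<close> serves on both sides: expanding the deformed products turns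
  \<open>\<rho> (v\<^sub>1 \<cdot>\<^sub>\<psi> v\<^sub>2) = \<rho> v\<^sub>1 \<cdot>\<^sub>\<phi> \<rho> v\<^sub>2\<close> into the equation defining \<open>\<psi> \<sim> \<phi>\<close>.
\<close>

lemma equivalent_iff_iso:
  assumes "\<psi> \<in> DM" "\<phi> \<in> DM"
  shows "deformation_equivalent scale m V br bl \<psi> \<phi> \<longleftrightarrow>
    perm_iso_on scale V (V_prod \<psi>) V (V_prod \<phi>)"
proof -
  have "\<rho> (m v1 v2) - m (\<rho> v1) (\<rho> v2) =
      br (\<phi> (\<rho> v1)) (\<rho> v2) + bl (\<rho> v1) (\<phi> (\<rho> v2)) - \<rho> (br (\<psi> v1) v2) - \<rho> (bl v1 (\<psi> v2)) \<longleftrightarrow>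
      \<rho> (V_prod \<psi> v1 v2) = V_prod \<phi> (\<rho> v1) (\<rho> v2)"
    if "linear_map_on scale V V \<rho>" "v1 \<in> V" "v2 \<in> V" for \<rho> v1 v2
    unfolding linear_V_prod[OF that(1) DM_linear[OF assms(1)] that(2,3)]
    by (simp add: deformed_product_def) (auto simp: algebra_simps)
  then show ?thesis
    unfolding deformation_equivalent_def perm_iso_on_def by blast
qed

lemma deformation_rel_eq_kernel:
  "deformation_rel scale m A V br bl wr wl =
    {(\<psi>, \<phi>). \<psi> \<in> DM \<and> \<phi> \<in> DM \<and>
      perm_iso_class scale V (V_prod \<psi>) = perm_iso_class scale V (V_prod \<phi>)}"
  using equivalent_iff_iso perm_iso_class_eq_iff[OF perm_algebra_V_prod perm_algebra_V_prod]
  unfolding deformation_rel_def by blast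

lemma class_V_prod_eq_class_graph:
  assumes "\<psi> \<in> DM"
  shows "perm_iso_class scale V (V_prod \<psi>) = perm_iso_class scale ((\<lambda>v. \<psi> v + v) ` V) m"
proof -
  have "perm_algebra_on scale ((\<lambda>v. \<psi> v + v) ` V) m"
    using graph_complement[OF assms] perm_algebra_on_subalgebra[OF E]
    unfolding perm_complement_def by blast
  then show ?thesis
    using perm_iso_class_eq_iff[OF perm_algebra_V_prod[OF assms]] iso_graph[OF assms] by blast
qed

lemma complement_classes_eq_image:
  "complement_classes scale m A E = (\<lambda>\<psi>. perm_iso_class scale V (V_prod \<psi>)) ` DM"
proof (intro subset_antisym subsetI)
  fix X assume "X \<in> complement_classes scale m A E"
  then obtain W where "perm_complement scale m A E W" "X = perm_iso_class scale W m"
    by (auto simp: complement_classes_def)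
  moreover from this(1) obtain \<psi> where "\<psi> \<in> DM" "W = (\<lambda>v. \<psi> v + v) ` V"
    by (rule complement_is_graph)
  ultimately show "X \<in> (\<lambda>\<psi>. perm_iso_class scale V (V_prod \<psi>)) ` DM"
    using class_V_prod_eq_class_graph by simp
next
  fix X assume "X \<in> (\<lambda>\<psi>. perm_iso_class scale V (V_prod \<psi>)) ` DM"
  then show "X \<in> complement_classes scale m A E"
    using class_V_prod_eq_class_graph graph_complement unfolding complement_classes_def by auto
qed

end

theorem theorem2p20:
  fixes scale :: "'k::field_char_0 \<Rightarrow> 'e::ab_group_add \<Rightarrow> 'e"
    and m :: "'e \<Rightarrow> 'e \<Rightarrow> 'e"
    and E A V :: "'e set"
    and br bl wr wl :: "'e \<Rightarrow> 'e \<Rightarrow> 'e"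
  assumes "vector_space scale"
    and "perm_algebra_on scale E m"
    and "perm_subalgebra scale m A E"
    and "perm_complement scale m A E V"
    and "associated_matched_pair scale m A V br bl wr wl"
  shows "equiv (deformation_maps scale m A V br bl wr wl) (deformation_rel scale m A V br bl wr wl)
    \<and> (\<exists>\<Phi>. (\<forall>\<psi> \<in> deformation_maps scale m A V br bl wr wl.
              \<Phi> (deformation_rel scale m A V br bl wr wl `` {\<psi>}) =
                perm_iso_class scale V (deformed_product m br bl \<psi>))
          \<and> bij_betw \<Phi> (deformation_H2 scale m A V br bl wr wl) (complement_classes scale m A E))
    \<and> factorization_index scale m A E =o |deformation_H2 scale m A V br bl wr wl|"
proof -
  interpret perm_factorization scale m E A V br bl wr wl
    using assms by (simp add: perm_factorization_def perm_factorization_axioms_def)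
  obtain \<Phi> where \<Phi>:
      "\<And>\<psi>. \<psi> \<in> DM \<Longrightarrow> \<Phi> (deformation_rel scale m A V br bl wr wl `` {\<psi>}) =
        perm_iso_class scale V (V_prod \<psi>)"
      "bij_betw \<Phi> (deformation_H2 scale m A V br bl wr wl) (complement_classes scale m A E)"
    unfolding deformation_H2_def deformation_rel_eq_kernel complement_classes_eq_image
    using bij_betw_quotient_kernel[of DM "\<lambda>\<psi>. perm_iso_class scale V (V_prod \<psi>)"] by blast
  have "|deformation_H2 scale m A V br bl wr wl| =o |complement_classes scale m A E|"
    using \<Phi>(2) card_of_ordIso by blast
  then have "factorization_index scale m A E =o |deformation_H2 scale m A V br bl wr wl|"
    unfolding factorization_index_def by (rule ordIso_symmetric)
  moreover have "equiv DM (deformation_rel scale m A V br bl wr wl)"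
    unfolding deformation_rel_eq_kernel by (rule equiv_kernel)
  ultimately show ?thesis
    using \<Phi> by blast
qed

end
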